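(* Consider an accelerated segment $\rho_{i,j} \in \rho_i^A$ of a task $\tau_i \in \Gamma$, and let $l_{i,x} = \mathcal{Q}(\rho_{i,j})$ be the corresponding suspension region of the self-suspending task $\tau^{\mathrm{ss}}_i$ matching $\tau_i$. Then, if the hardware accelerator $\mathcal{H}$ is scheduled by round-robin, the duration of $l_{i,x}$ is bounded by $$S_{i,x} = E_{i,j}(\mathcal{H}) + \sum_{\rho_{h,u} \in \mathcal{I}(\tau_i)} E_{h,u}(\mathcal{H}),$$ where $\mathcal{I}(\tau_i)$ is the set containing, for each task $\tau_h \in \Gamma \setminus \{\tau_i\}$ with $\rho_h^A \neq \emptyset$, the accelerated segment $\rho_{h,u} \in \rho_h^A$ with the longest execution phase on $\mathcal{H}$ (i.e., with the largest $E_{h,u}(\mathcal{H})$) among all segments in $\rho_h^A$.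
   Context: Platform and tasks. The platform has a set of processor cores $p_1,\dots,p_m$ and a single hardware accelerator $\mathcal{H}$. The application is a finite set $\Gamma = \{\tau_1,\dots,\tau_n\}$ of periodic real-time tasks; each task is statically allocated to one core and has a unique fixed priority; each core uses preemptive fixed-priority scheduling. Task $\tau_i$ releases jobs with period $T_i$, each job having to complete within a relative deadline $D_i \le T_i$ from its release. Each task $\tau_i$ is a finite sequence $\rho_i = \{\rho_{i,1},\dots,\rho_{i,w}\}$ of code segments, executed sequentially: a segment $\rho_{i,j}$, $j>1$, of a job starts only after the completion of $\rho_{i,j-1}$. Each segment is either accelerated or not; $\rho_i^A \subseteq \rho_i$ is the set of accelerated segments of $\tau_i$. Offloading (synchronous, suspension-based). A non-accelerated segment consists only of a processing (execution) phase on the core $p_k$ of its task, with worst-case execution time (WCET) $E_{i,j}(p_k)$. An accelerated segment $\rho_{i,j}$ of a task on core $p_k$ first executes an offloading phase on $p_k$ (WCET $O_{i,j}(p_k)$); upon its completion the task suspends on $p_k$ and the processing (execution) phase is requested on, and runs on, $\mathcal{H}$ (WCET $E_{i,j}(\mathcal{H})$); when this completes, the task is awakened on $p_k$ and executes a finalization phase (WCET $F_{i,j}(p_k)$), which terminates the segment. Matching self-suspending task. The task $\tau_i$ on $p_k$ is mapped to a self-suspending task $\tau^{\mathrm{ss}}_i$, i.e., an ordered sequence of regions $l_{i,1}, l_{i,2},\dots$ alternating between execution and suspension regions: each non-accelerated segment is mapped to an execution region; for each accelerated segment, the offloading phase is mapped to an execution region, the processing phase on $\mathcal{H}$ to a suspension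 region, and the finalization phase to an execution region; consecutive execution regions are merged. $\mathcal{Q}(\rho_{i,j})$ denotes the suspension region corresponding to accelerated segment $\rho_{i,j}$. Its duration is the response time of the processing phase on the accelerator, i.e., the time from when the task suspends on its core to request acceleration until the completion of the processing phase on $\mathcal{H}$. Round-robin on the accelerator. The accelerator serves tasks in a cyclic fashion, where at each turn a task executes up to one accelerated execution phase; an execution phase, once started, runs to completion on $\mathcal{H}$ without preemption. *)

theory Defs
  imports "HOL-Analysis.Lebesgue_Measure"
begin

text \<open>Segments, jobs, phases, regions and turns are all numbered from 0.\<close>

section \<open>Platform and tasks\<close>

datatype 'c resource = Core 'c | Accelerator

text \<open>
  The worst-case execution times \<open>E\<close>, \<open>O\<close> and \<open>F\<close> of a segment depend on the resource. Only the
  values at the core of the task and, for accelerated segments, at the accelerator are meaningful.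
\<close>

record 'c segment =
  accelerated :: bool
  exec_wcet :: "'c resource \<Rightarrow> real"
  offload_wcet :: "'c \<Rightarrow> real"
  final_wcet :: "'c \<Rightarrow> real"

record 'c task =
  core :: 'c
  priority :: nat  \<comment> \<open>a larger number is a higher priority\<close>
  period :: real
  deadline :: real
  segments :: "'c segment list"

record ('t, 'c) system =
  cores :: "'c set"
  tasks :: "'t set"
  task_of :: "'t \<Rightarrow> 'c task"

definition num_segments :: "('t, 'c) system \<Rightarrow> 't \<Rightarrow> nat" where
  "num_segments S i = length (segments (task_of S i))"

definition segment :: "('t, 'c) system \<Rightarrow> 't \<Rightarrow> nat \<Rightarrow> 'c segment" where
  "segment S i j = segments (task_of S i) ! j"

definition accel_segments :: "('t, 'c) system \<Rightarrow> 't \<Rightarrow> nat set" where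
  "accel_segments S i = {j. j < num_segments S i \<and> accelerated (segment S i j)}"

definition accel_wcet :: "('t, 'c) system \<Rightarrow> 't \<Rightarrow> nat \<Rightarrow> real" where
  "accel_wcet S i j = exec_wcet (segment S i j) Accelerator"

datatype phase = Offloading nat | Processing nat | Finalization nat

definition segment_phases :: "('t, 'c) system \<Rightarrow> 't \<Rightarrow> nat \<Rightarrow> phase list" where
  "segment_phases S i j =
     (if accelerated (segment S i j) then [Offloading j, Processing j, Finalization j]
      else [Processing j])"

definition phases :: "('t, 'c) system \<Rightarrow> 't \<Rightarrow> phase list" where
  "phases S i = concat (map (segment_phases S i) [0..<num_segments S i])"

fun phase_resource :: "('t, 'c) system \<Rightarrow> 't \<Rightarrow> phase \<Rightarrow> 'c resource" where
  "phase_resource S i (Offloading j) = Core (core (task_of S i))"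
| "phase_resource S i (Processing j) =
     (if accelerated (segment S i j) then Accelerator else Core (core (task_of S i)))"
| "phase_resource S i (Finalization j) = Core (core (task_of S i))"

fun phase_wcet :: "('t, 'c) system \<Rightarrow> 't \<Rightarrow> phase \<Rightarrow> real" where
  "phase_wcet S i (Offloading j) = offload_wcet (segment S i j) (core (task_of S i))"
| "phase_wcet S i (Processing j) =
     exec_wcet (segment S i j) (phase_resource S i (Processing j))"
| "phase_wcet S i (Finalization j) = final_wcet (segment S i j) (core (task_of S i))"

definition valid_system :: "('t, 'c) system \<Rightarrow> bool" where
  "valid_system S \<longleftrightarrow>
     finite (cores S) \<and> finite (tasks S) \<and> inj_on (\<lambda>i. priority (task_of S i)) (tasks S) \<and>
     (\<forall>i\<in>tasks S.
        core (task_of S i) \<in> cores S \<and>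
        0 < deadline (task_of S i) \<and> deadline (task_of S i) \<le> period (task_of S i) \<and>
        segments (task_of S i) \<noteq> [] \<and>
        (\<forall>\<phi>\<in>set (phases S i). 0 \<le> phase_wcet S i \<phi>))"

section \<open>Matching self-suspending task\<close>

datatype region = Execution "phase list" | Suspension phase

fun merge_regions :: "region list \<Rightarrow> region list" where
  "merge_regions (Execution ps # Execution qs # rs) = merge_regions (Execution (ps @ qs) # rs)"
| "merge_regions (r # rs) = r # merge_regions rs"
| "merge_regions [] = []"

definition phase_region :: "('t, 'c) system \<Rightarrow> 't \<Rightarrow> phase \<Rightarrow> region" where
  "phase_region S i \<phi> =
     (if phase_resource S i \<phi> = Accelerator then Suspension \<phi> else Execution [\<phi>])"

definition ss_task :: "('t, 'c) system \<Rightarrow> 't \<Rightarrow> region list" where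
  "ss_task S i = merge_regions (map (phase_region S i) (phases S i))"

text \<open>The suspension region \<open>Q\<close> of an accelerated segment.\<close>

definition susp_region :: "nat \<Rightarrow> region" where
  "susp_region j = Suspension (Processing j)"

fun region_phases :: "region \<Rightarrow> phase list" where
  "region_phases (Execution ps) = ps"
| "region_phases (Suspension \<phi>) = [\<phi>]"

text \<open>Position in \<^term>\<open>phases S i\<close> of the first phase of region \<open>x\<close>.\<close>

definition region_pos :: "('t, 'c) system \<Rightarrow> 't \<Rightarrow> nat \<Rightarrow> nat" where
  "region_pos S i x = length (concat (map region_phases (take x (ss_task S i))))"

section \<open>Schedules\<close>

text \<open>
  A schedule is one possible run of the system from time 0. A triple \<open>(i, k, p)\<close> stands for phase
  \<^term>\<open>phases S i ! p\<close> of job \<open>k\<close> of task \<open>i\<close>; \<open>demand\<close> is the time it actually executes, and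
  \<open>completion\<close> is \<open>None\<close> if it never completes. The accelerator goes through turns; \<open>turn q\<close> is
  the time at which turn \<open>q\<close> begins and \<open>served q\<close> the phase executed in it, if any.
\<close>

record ('t, 'c) schedule =
  first_release :: "'t \<Rightarrow> real"
  demand :: "'t \<Rightarrow> nat \<Rightarrow> nat \<Rightarrow> real"
  completion :: "'t \<Rightarrow> nat \<Rightarrow> nat \<Rightarrow> real option"
  running :: "'c \<Rightarrow> real \<Rightarrow> 't option"
  turn :: "nat \<Rightarrow> real"
  served :: "nat \<Rightarrow> ('t \<times> nat \<times> nat) option"

definition release :: "('t, 'c) system \<Rightarrow> ('t, 'c) schedule \<Rightarrow> 't \<Rightarrow> nat \<Rightarrow> real" where
  "release S B i k = first_release B i + real k * period (task_of S i)"

text \<open>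
  The time at which a phase becomes ready. The phases of a job are sequential, and so are the jobs
  of a task: a job released while the preceding one is unfinished (after a deadline miss, since
  deadlines do not exceed periods) begins when that one completes.
\<close>

fun ready :: "('t, 'c) system \<Rightarrow> ('t, 'c) schedule \<Rightarrow> 't \<Rightarrow> nat \<Rightarrow> nat \<Rightarrow> real option" where
  "ready S B i k (Suc p) = completion B i k p"
| "ready S B i 0 0 = Some (release S B i 0)"
| "ready S B i (Suc k) 0 =
     map_option (max (release S B i (Suc k))) (completion B i k (length (phases S i) - 1))"

definition is_accel_phase :: "('t, 'c) system \<Rightarrow> 't \<Rightarrow> nat \<Rightarrow> bool" where
  "is_accel_phase S i p \<longleftrightarrow>
     p < length (phases S i) \<and> phase_resource S i (phases S i ! p) = Accelerator"

definition is_core_phase :: "('t, 'c) system \<Rightarrow> 't \<Rightarrow> nat \<Rightarrow> bool" where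
  "is_core_phase S i p \<longleftrightarrow>
     p < length (phases S i) \<and> phase_resource S i (phases S i ! p) = Core (core (task_of S i))"

subsection \<open>Cores\<close>

definition active_on_core :: "('t, 'c) system \<Rightarrow> ('t, 'c) schedule \<Rightarrow> 't \<Rightarrow> real \<Rightarrow> bool" where
  "active_on_core S B i t \<longleftrightarrow>
     (\<exists>k p r. is_core_phase S i p \<and> ready S B i k p = Some r \<and> r \<le> t \<and>
        (\<forall>f. completion B i k p = Some f \<longrightarrow> t < f))"

definition fixed_priority :: "('t, 'c) system \<Rightarrow> ('t, 'c) schedule \<Rightarrow> bool" where
  "fixed_priority S B \<longleftrightarrow>
     (\<forall>c\<in>cores S. \<forall>t i. running B c t = Some i \<longleftrightarrow>
        i \<in> tasks S \<and> core (task_of S i) = c \<and> active_on_core S B i t \<and>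
        (\<forall>h\<in>tasks S. core (task_of S h) = c \<and> active_on_core S B h t \<longrightarrow>
           priority (task_of S h) \<le> priority (task_of S i)))"

definition core_service ::
    "('t, 'c) system \<Rightarrow> ('t, 'c) schedule \<Rightarrow> 't \<Rightarrow> real \<Rightarrow> real \<Rightarrow> real" where
  "core_service S B i a b =
     measure lborel {t \<in> {a..<b}. running B (core (task_of S i)) t = Some i}"

definition legal_schedule :: "('t, 'c) system \<Rightarrow> ('t, 'c) schedule \<Rightarrow> bool" where
  "legal_schedule S B \<longleftrightarrow>
     (\<forall>i\<in>tasks S. 0 \<le> first_release B i) \<and>
     (\<forall>i\<in>tasks S. \<forall>k. \<forall>p<length (phases S i).
        0 \<le> demand B i k p \<and> demand B i k p \<le> phase_wcet S i (phases S i ! p)) \<and>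
     (\<forall>i\<in>tasks S. \<forall>k p f. is_core_phase S i p \<longrightarrow>
        (completion B i k p = Some f \<longleftrightarrow>
           (\<exists>r. ready S B i k p = Some r \<and> r \<le> f \<and> core_service S B i r f = demand B i k p \<and>
              (\<forall>t. r \<le> t \<and> t < f \<longrightarrow> core_service S B i r t < demand B i k p)))) \<and>
     fixed_priority S B"

subsection \<open>Round-robin on the accelerator\<close>

definition pending :: "('t, 'c) system \<Rightarrow> ('t, 'c) schedule \<Rightarrow> nat \<Rightarrow> 't \<Rightarrow> nat \<Rightarrow> nat \<Rightarrow> bool" where
  "pending S B q i k p \<longleftrightarrow>
     i \<in> tasks S \<and> is_accel_phase S i p \<and> (\<exists>r. ready S B i k p = Some r \<and> r \<le> turn B q) \<and>
     (\<forall>q'<q. served B q' \<noteq> Some (i, k, p))"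

text \<open>
  If the task \<open>i\<close> whose turn it is has a pending phase, one such phase runs to completion and then
  the next turn begins. Otherwise the turn passes on at once if any other task has a pending phase;
  if there is none, the accelerator idles, and it may pass the turn on at any time (whether it
  keeps rotating while idle is left open), but no later than the next request.
\<close>

definition turn_rule :: "('t, 'c) system \<Rightarrow> ('t, 'c) schedule \<Rightarrow> 't \<Rightarrow> nat \<Rightarrow> bool" where
  "turn_rule S B i q \<longleftrightarrow>
     (if \<exists>k p. pending S B q i k p then
        \<exists>k p. pending S B q i k p \<and> served B q = Some (i, k, p) \<and>
          turn B (Suc q) = turn B q + demand B i k p
      else
        served B q = None \<and>
        (if \<exists>h k p. pending S B q h k p then turn B (Suc q) = turn B q
         else
           turn B q \<le> turn B (Suc q) \<and>
           (\<forall>h\<in>tasks S. \<forall>k p r. is_accel_phase S h p \<and> ready S B h k p = Some r \<longrightarrow>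
              r \<le> turn B q \<or> turn B (Suc q) \<le> r)))"

text \<open>The condition that turns reach beyond any time excludes infinitely many turns in finite time.\<close>

definition round_robin :: "('t, 'c) system \<Rightarrow> ('t, 'c) schedule \<Rightarrow> bool" where
  "round_robin S B \<longleftrightarrow>
     (\<exists>cyc. distinct cyc \<and> set cyc = tasks S \<and>
        (\<forall>q. turn_rule S B (cyc ! (q mod length cyc)) q)) \<and>
     turn B 0 = 0 \<and> (\<forall>t. \<exists>q. t < turn B q) \<and>
     (\<forall>i\<in>tasks S. \<forall>k p f. is_accel_phase S i p \<longrightarrow>
        (completion B i k p = Some f \<longleftrightarrow>
           (\<exists>q. served B q = Some (i, k, p) \<and> f = turn B (Suc q))))"

subsection \<open>Extent of a region in a job\<close>

definition region_start ::
    "('t, 'c) system \<Rightarrow> ('t, 'c) schedule \<Rightarrow> 't \<Rightarrow> nat \<Rightarrow> nat \<Rightarrow> real option" where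
  "region_start S B i k x = ready S B i k (region_pos S i x)"

definition region_end ::
    "('t, 'c) system \<Rightarrow> ('t, 'c) schedule \<Rightarrow> 't \<Rightarrow> nat \<Rightarrow> nat \<Rightarrow> real option" where
  "region_end S B i k x =
     completion B i k (region_pos S i x + length (region_phases (ss_task S i ! x)) - 1)"

section \<open>Interfering segments\<close>

text \<open>Ties for the longest execution phase are broken by an arbitrary but fixed choice.\<close>

definition interference :: "('t, 'c) system \<Rightarrow> 't \<Rightarrow> ('t \<times> nat) set" where
  "interference S i =
     {(h, u). h \<in> tasks S - {i} \<and> accel_segments S h \<noteq> {} \<and>
        u = arg_max_on (accel_wcet S h) (accel_segments S h)}"

end

theory Submission
  imports Defs
begin

text \<open>
  Suppose the request of task \<open>i\<close> becomes ready at time \<open>s\<close>, and let \<open>q\<close> be the last turn that begins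
  no later than \<open>s\<close>. From turn \<open>q\<close> up to the first turn \<open>m \<ge> q\<close> of \<open>i\<close>, the accelerator never idles
  past \<open>s\<close>, and the turns \<open>q, \<dots>, m - 1\<close> belong to pairwise distinct tasks other than \<open>i\<close>, each of
  which executes at most its longest accelerated phase. Starting at the \<^emph>\<open>last\<close> such turn matters
  because phases of zero length allow arbitrarily many turns, and even several requests of the same
  task, at the single instant \<open>s\<close>. In turn \<open>m\<close> the request itself is served: an earlier phase of \<open>i\<close>
  has completed by \<open>s\<close>, and a later one is not ready before the request completes.
\<close>

section \<open>Regions and phases\<close>

text \<open>Merging only appends the phase lists of adjacent execution regions, so flattening does
  not notice it. This is what lets positions among regions be translated into positions in
  \<open>phases S i\<close>.\<close>

lemma concat_region_phases_merge:
  "concat (map region_phases (merge_regions rs)) = concat (map region_phases rs)"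
  by (induction rs rule: merge_regions.induct) auto

lemma concat_region_phases_ss_task: "concat (map region_phases (ss_task S i)) = phases S i"
proof -
  have "region_phases (phase_region S i \<phi>) = [\<phi>]" for \<phi>
    by (simp add: phase_region_def)
  then show ?thesis
    by (simp add: ss_task_def concat_region_phases_merge comp_def)
qed

lemma phases_region_pos:
  assumes "x < length (ss_task S i)" and "ss_task S i ! x = Suspension \<phi>"
  shows "region_pos S i x < length (phases S i)" and "phases S i ! region_pos S i x = \<phi>"
proof -
  let ?l = "ss_task S i"
  have "?l = take x ?l @ Suspension \<phi> # drop (Suc x) ?l"
    using id_take_nth_drop[OF assms(1)] assms(2) by simp
  then have "phases S i = concat (map region_phases (take x ?l)) @
      \<phi> # concat (map region_phases (drop (Suc x) ?l))"
    by (metis (no_types, lifting) append_Cons append_Nil concat.simps(2) concat_append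
        concat_region_phases_ss_task list.simps(9) map_append region_phases.simps(2))
  then show "region_pos S i x < length (phases S i)" "phases S i ! region_pos S i x = \<phi>"
    by (simp_all add: region_pos_def)
qed

lemma in_phases_Processing:
  assumes "j \<in> accel_segments S i"
  shows "Processing j \<in> set (phases S i)"
  using assms by (auto simp: phases_def accel_segments_def segment_phases_def intro!: bexI[of _ j])

lemma phase_wcet_Processing:
  assumes "j \<in> accel_segments S i"
  shows "phase_wcet S i (Processing j) = accel_wcet S i j"
  using assms by (simp add: accel_segments_def accel_wcet_def)

lemma is_accel_phaseE:
  assumes "is_accel_phase S i p"
  obtains u where "u \<in> accel_segments S i" and "phases S i ! p = Processing u"
proof -
  have mem: "phases S i ! p \<in> set (phases S i)"
    and acc: "phase_resource S i (phases S i ! p) = Accelerator"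
    using assms by (auto simp: is_accel_phase_def)
  from acc obtain u where u: "phases S i ! p = Processing u" "accelerated (segment S i u)"
    by (cases "phases S i ! p") (auto split: if_splits)
  from mem have "u < num_segments S i"
    unfolding u by (auto simp: phases_def segment_phases_def split: if_splits)
  with u that show thesis
    by (auto simp: accel_segments_def)
qed

lemma core_or_accel_phase:
  assumes "p < length (phases S i)"
  shows "is_core_phase S i p \<or> is_accel_phase S i p"
  using assms by (cases "phases S i ! p") (auto simp: is_core_phase_def is_accel_phase_def)

section \<open>The longest accelerated phase of a task\<close>

text \<open>The value 0 for a task without accelerated segments lets the interference be summed over
  all other tasks, instead of over chosen pairs of task and segment.\<close>

definition max_accel_wcet :: "('t, 'c) system \<Rightarrow> 't \<Rightarrow> real" where
  "max_accel_wcet S h =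
     (if accel_segments S h = {} then 0
      else accel_wcet S h (arg_max_on (accel_wcet S h) (accel_segments S h)))"

lemma finite_accel_segments: "finite (accel_segments S h)"
  by (simp add: accel_segments_def)

lemma arg_max_on_finite:
  fixes f :: "'a \<Rightarrow> 'b::linorder"
  assumes "finite A" and "A \<noteq> {}"
  shows "arg_max_on f A \<in> A" and "a \<in> A \<Longrightarrow> f a \<le> f (arg_max_on f A)"
proof -
  \<comment> \<open>\<open>arg_max_on\<close> is a choice operator, so a maximiser has to be
    exhibited; finiteness of the image supplies one.\<close>
  have "Max (f ` A) \<in> f ` A"
    using assms by simp
  then obtain b where b: "b \<in> A" "f b = Max (f ` A)"
    by auto
  have "arg_max_on f A \<in> A \<and> (\<forall>a\<in>A. f a \<le> f (arg_max_on f A))"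
    unfolding arg_max_on_def
    by (rule arg_maxI[where x = b]) (use assms b in \<open>auto simp: not_less\<close>)
  then show "arg_max_on f A \<in> A" "a \<in> A \<Longrightarrow> f a \<le> f (arg_max_on f A)"
    by auto
qed

lemma accel_wcet_le_max: "u \<in> accel_segments S h \<Longrightarrow> accel_wcet S h u \<le> max_accel_wcet S h"
  by (auto simp: max_accel_wcet_def intro!: arg_max_on_finite(2) finite_accel_segments)

lemma accel_wcet_nonneg:
  assumes "valid_system S" and "h \<in> tasks S" and "u \<in> accel_segments S h"
  shows "0 \<le> accel_wcet S h u"
  using assms in_phases_Processing[OF assms(3)] phase_wcet_Processing[OF assms(3)]
  unfolding valid_system_def by metis

lemma max_accel_wcet_nonneg:
  assumes "valid_system S" and "h \<in> tasks S"
  shows "0 \<le> max_accel_wcet S h"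
  using assms
  by (auto simp: max_accel_wcet_def intro!: accel_wcet_nonneg arg_max_on_finite(1) finite_accel_segments)

lemma sum_interference:
  assumes "finite (tasks S)"
  shows "(\<Sum>(h, u)\<in>interference S i. accel_wcet S h u) = (\<Sum>h\<in>tasks S - {i}. max_accel_wcet S h)"
proof -
  let ?H = "{h \<in> tasks S - {i}. accel_segments S h \<noteq> {}}"
  let ?g = "\<lambda>h. (h, arg_max_on (accel_wcet S h) (accel_segments S h))"
  have "interference S i = ?g ` ?H"
    by (auto simp: interference_def)
  then have "(\<Sum>(h, u)\<in>interference S i. accel_wcet S h u) = (\<Sum>h\<in>?H. max_accel_wcet S h)"
    by (simp add: sum.reindex inj_on_def max_accel_wcet_def)
  also have "\<dots> = (\<Sum>h\<in>tasks S - {i}. max_accel_wcet S h)"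
    by (rule sum.mono_neutral_left) (use assms in \<open>auto simp: max_accel_wcet_def\<close>)
  finally show ?thesis .
qed

section \<open>Cyclic order\<close>

lemma inj_on_mod_window: "inj_on (\<lambda>m. m mod n) {q..<q + n}" for n q :: nat
proof (rule linorder_inj_onI)
  fix a b assume ab: "a < b" "a \<in> {q..<q + n}" "b \<in> {q..<q + n}"
  show "a mod n \<noteq> b mod n"
  proof
    assume "a mod n = b mod n"
    then have "n dvd b - a"
      using ab by (metis less_imp_le_nat mod_eq_dvd_iff_nat)
    then show False
      using ab by (auto dest!: dvd_imp_le)
  qed
qed auto

lemma mod_window_image:
  fixes n q :: nat
  shows "(\<lambda>m. m mod n) ` {q..<q + n} = {..<n}"
  by (rule card_subset_eq) (auto simp: card_image[OF inj_on_mod_window])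

text \<open>A window of \<open>length xs\<close> consecutive turns meets every residue once, so the
  first visit \<open>m\<close> to \<open>a\<close> lies in the window starting at \<open>q\<close>.
  The turns before \<open>m\<close> therefore have distinct owners, and minimality of
  \<open>m\<close> keeps \<open>a\<close> out of them.\<close>

lemma next_visit:
  assumes "distinct xs" and "a \<in> set xs"
  obtains m where "q \<le> m" and "xs ! (m mod length xs) = a"
    and "inj_on (\<lambda>r. xs ! (r mod length xs)) {q..<m}"
    and "(\<lambda>r. xs ! (r mod length xs)) ` {q..<m} \<subseteq> set xs - {a}"
proof -
  let ?n = "length xs"
  let ?P = "\<lambda>m. q \<le> m \<and> xs ! (m mod ?n) = a"
  have n: "0 < ?n"
    using assms(2) by (cases xs) auto
  obtain b where b: "b < ?n" "xs ! b = a"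
    using assms(2) by (auto simp: in_set_conv_nth)
  then have "b \<in> (\<lambda>m. m mod ?n) ` {q..<q + ?n}"
    unfolding mod_window_image by simp
  then obtain m0 where m0: "m0 \<in> {q..<q + ?n}" "m0 mod ?n = b"
    by auto
  define m where "m = (LEAST m. ?P m)"
  have "?P m0"
    using m0 b by auto
  then have m: "?P m" "m \<le> m0"
    unfolding m_def by (rule LeastI, rule Least_le)
  have "inj_on (\<lambda>r. r mod ?n) {q..<m}"
    by (rule inj_on_subset[OF inj_on_mod_window[of _ q]]) (use m m0 in auto)
  then have "inj_on (\<lambda>r. xs ! (r mod ?n)) {q..<m}"
    using assms(1) n by (auto simp: inj_on_def nth_eq_iff_index_eq)
  moreover have "(\<lambda>r. xs ! (r mod ?n)) ` {q..<m} \<subseteq> set xs - {a}"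
    using n not_less_Least[of _ ?P] by (force simp: m_def)
  ultimately show thesis
    using m that by blast
qed

section \<open>Round-robin runs\<close>

text \<open>Fixing a witness \<open>cyc\<close> of the existential in \<open>round_robin\<close>
  gives every turn a definite owner.\<close>

locale round_robin_run =
  fixes S :: "('t, 'c) system" and B :: "('t, 'c) schedule" and cyc :: "'t list"
  assumes valid: "valid_system S"
    and legal: "legal_schedule S B"
    and rr: "round_robin S B"
    and distinct_cyc: "distinct cyc"
    and set_cyc: "set cyc = tasks S"
    and turn_rule: "\<And>q. turn_rule S B (cyc ! (q mod length cyc)) q"
begin

abbreviation owner :: "nat \<Rightarrow> 't" where
  "owner q \<equiv> cyc ! (q mod length cyc)"

lemma finite_tasks: "finite (tasks S)"
  using valid by (simp add: valid_system_def)

lemma demand_bounds: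
  assumes "i \<in> tasks S" and "p < length (phases S i)"
  shows "0 \<le> demand B i k p" and "demand B i k p \<le> phase_wcet S i (phases S i ! p)"
  using legal assms by (auto simp: legal_schedule_def)

lemma served_pending:
  assumes "served B q = Some (i, k, p)"
  shows "i = owner q" and "pending S B q i k p" and "turn B (Suc q) = turn B q + demand B i k p"
  using turn_rule[of q] assms by (auto simp: turn_rule_def split: if_splits)

lemma owner_pendingE:
  assumes "pending S B q (owner q) k p"
  obtains k' p' where "served B q = Some (owner q, k', p')"
  using turn_rule[of q] assms by (auto simp: turn_rule_def split: if_splits)

lemma pendingD:
  assumes "pending S B q i k p"
  shows "i \<in> tasks S" and "is_accel_phase S i p" and "p < length (phases S i)"
  using assms by (auto simp: pending_def is_accel_phase_def)

lemma served_demand_le: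
  assumes "served B q = Some (i, k, p)"
  shows "demand B i k p \<le> max_accel_wcet S i"
proof -
  note pend = pendingD[OF served_pending(2)[OF assms]]
  obtain u where u: "u \<in> accel_segments S i" "phases S i ! p = Processing u"
    using pend(2) by (rule is_accel_phaseE)
  have "demand B i k p \<le> accel_wcet S i u"
    using demand_bounds(2)[OF pend(1,3), of k] u phase_wcet_Processing[OF u(1)] by simp
  then show ?thesis
    using accel_wcet_le_max[OF u(1)] by simp
qed

lemma turn_le_Suc: "turn B q \<le> turn B (Suc q)"
proof (cases "served B q")
  case None
  then show ?thesis
    using turn_rule[of q] by (auto simp: turn_rule_def split: if_splits)
next
  case (Some a)
  then obtain i k p where a: "served B q = Some (i, k, p)"
    by (cases a) auto
  show ?thesis
    using served_pending(3)[OF a] demand_bounds(1)[OF pendingD(1,3)[OF served_pending(2)[OF a]]]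
    by simp
qed

lemma turn_mono: "q \<le> q' \<Longrightarrow> turn B q \<le> turn B q'"
  by (rule lift_Suc_mono_le[of "turn B"]) (auto simp: turn_le_Suc)

lemma turn_0: "turn B 0 = 0"
  using rr by (simp add: round_robin_def)

lemma accel_completion_iff:
  assumes "i \<in> tasks S" and "is_accel_phase S i p"
  shows "completion B i k p = Some f \<longleftrightarrow> (\<exists>q. served B q = Some (i, k, p) \<and> f = turn B (Suc q))"
  using rr assms by (simp add: round_robin_def)

lemma completion_served:
  assumes "served B q = Some (i, k, p)"
  shows "completion B i k p = Some (turn B (Suc q))"
  using accel_completion_iff pendingD[OF served_pending(2)[OF assms]] assms by blast

lemma completion_imp_ready:
  assumes "i \<in> tasks S" and "p < length (phases S i)" and "completion B i k p = Some f"
  obtains r where "ready S B i k p = Some r" and "r \<le> f"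
proof (cases "is_core_phase S i p")
  case True
  note legal[unfolded legal_schedule_def, THEN conjunct2, THEN conjunct2, THEN conjunct1,
      rule_format, OF assms(1) True, THEN iffD1, OF assms(3)]
  with that show thesis
    by (elim exE conjE)
next
  case False
  then have "is_accel_phase S i p"
    using core_or_accel_phase[OF assms(2)] by simp
  then obtain q where q: "served B q = Some (i, k, p)" "f = turn B (Suc q)"
    using assms(1,3) by (auto simp: accel_completion_iff)
  obtain r where "ready S B i k p = Some r" "r \<le> turn B q"
    using served_pending(2)[OF q(1)] by (auto simp: pending_def)
  with q turn_le_Suc[of q] that show thesis
    by fastforce
qed

lemma release_nonneg:
  assumes "i \<in> tasks S"
  shows "0 \<le> release S B i k"
proof -
  have "0 < deadline (task_of S i)" "deadline (task_of S i) \<le> period (task_of S i)"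
    using valid assms by (auto simp: valid_system_def)
  moreover have "0 \<le> first_release B i"
    using legal assms by (simp add: legal_schedule_def)
  ultimately show ?thesis
    by (simp add: release_def)
qed

text \<open>Since turn 0 begins at time 0, this ensures that some turn begins no later than any
  given request.\<close>

lemma ready_nonneg:
  assumes "i \<in> tasks S" and "p < length (phases S i)" and "ready S B i k p = Some r"
  shows "0 \<le> r"
  using assms(2,3)
proof (induction p arbitrary: r)
  case 0
  then show ?case
    using release_nonneg[OF assms(1), of k] by (cases k) auto
next
  case (Suc p)
  then obtain r' where "ready S B i k p = Some r'" "r' \<le> r"
    using completion_imp_ready[OF assms(1), of p k r] by auto
  with Suc show ?case
    by fastforce
qed

text \<open>The index \<open>p'\<close> may equal the number of phases: readiness at that index is
  by definition completion of the last phase, which is how the argument is applied to a whole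
  finished job.\<close>

lemma earlier_phase_completed:
  assumes "i \<in> tasks S" and "p' \<le> length (phases S i)" and "ready S B i k p' = Some r" and "p < p'"
  obtains f where "completion B i k p = Some f" and "f \<le> r"
proof -
  have "\<exists>f. completion B i k p = Some f \<and> f \<le> r"
    using assms(2-4)
  proof (induction p' arbitrary: r)
    case (Suc m)
    show ?case
    proof (cases "p = m")
      case False
      obtain r' where "ready S B i k m = Some r'" "r' \<le> r"
        using completion_imp_ready[OF assms(1), of m k r] Suc.prems by auto
      with Suc False show ?thesis
        by fastforce
    qed (use Suc in auto)
  qed simp
  with that show thesis
    by blast
qed

lemma earlier_job_completed:
  assumes "i \<in> tasks S" and "p' < length (phases S i)" and "ready S B i k' p' = Some r"
    and "k < k'" and "p < length (phases S i)"
  obtains f where "completion B i k p = Some f" and "f \<le> r"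
proof -
  let ?L = "length (phases S i)"
  have first: "\<exists>r0. ready S B i k' 0 = Some r0 \<and> r0 \<le> r"
    if p': "p' < ?L" and r: "ready S B i k' p' = Some r" for k' p' r
  proof (cases p')
    case (Suc n)
    obtain f where "completion B i k' 0 = Some f" "f \<le> r"
      using earlier_phase_completed[OF assms(1) _ r, of 0] p' Suc by auto
    then show ?thesis
      using completion_imp_ready[OF assms(1), of 0 k' f] p' by force
  qed (use r in auto)
  have "\<exists>f. completion B i k p = Some f \<and> f \<le> r"
    using assms(2-4)
  proof (induction k' arbitrary: r p')
    case (Suc m)
    \<comment> \<open>Phase 0 of job \<open>Suc m\<close> is ready at the maximum of its release and
      the completion of job \<open>m\<close>, so the latter is defined and no later.\<close>
    obtain f0 where f0: "completion B i m (?L - 1) = Some f0" "f0 \<le> r"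
      using first[OF Suc.prems(1,2)] by auto
    show ?case
    proof (cases "k = m")
      case True
      have "ready S B i m ?L = Some f0"
        using f0 assms(5) by (cases ?L) auto
      then show ?thesis
        using earlier_phase_completed[OF assms(1) order_refl _ assms(5)] f0 True by fastforce
    next
      case False
      have L: "?L - 1 < ?L"
        using assms(5) by simp
      obtain r1 where "ready S B i m (?L - 1) = Some r1" "r1 \<le> f0"
        using completion_imp_ready[OF assms(1) L f0(1)] by blast
      then show ?thesis
        using Suc.IH[OF L, of r1] Suc.prems(3) False f0 by fastforce
    qed
  qed simp
  with that show thesis
    by blast
qed

lemma phases_sequential:
  assumes "i \<in> tasks S" and "p < length (phases S i)" and "p' < length (phases S i)"
    and "ready S B i k' p' = Some r" and "k < k' \<or> k = k' \<and> p < p'"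
  obtains f where "completion B i k p = Some f" and "f \<le> r"
  using assms earlier_phase_completed earlier_job_completed by (metis less_imp_le)

text \<open>An idle turn cannot extend past a request, so a turn that ends after \<open>s\<close>
  has some pending phase. Then either its owner executes one phase or the turn passes on with zero
  length.\<close>

lemma turn_while_waiting:
  assumes ready: "i \<in> tasks S" "is_accel_phase S i p" "ready S B i k p = Some s"
    and late: "s < turn B (Suc q)"
    and unserved: "\<forall>q'<q. served B q' \<noteq> Some (i, k, p)"
    and tasks: "owner q \<in> tasks S"
  shows "turn B (Suc q) - turn B q \<le> max_accel_wcet S (owner q)"
    and "owner q = i \<Longrightarrow> \<exists>k p. served B q = Some (i, k, p)"
proof -
  have pend: "pending S B q i k p" if "s \<le> turn B q"
    using that ready unserved by (auto simp: pending_def)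
  have some_pending: "\<exists>h k p. pending S B q h k p"
  proof (rule ccontr)
    assume none: "\<not> ?thesis"
    then have "\<forall>h\<in>tasks S. \<forall>k p r. is_accel_phase S h p \<and> ready S B h k p = Some r \<longrightarrow>
        r \<le> turn B q \<or> turn B (Suc q) \<le> r"
      using turn_rule[of q] by (simp add: turn_rule_def)
    then have "s \<le> turn B q \<or> turn B (Suc q) \<le> s"
      using ready by blast
    with late pend none show False
      by auto
  qed
  have passes: "turn B (Suc q) = turn B q" if "\<nexists>k p. pending S B q (owner q) k p"
    using turn_rule[of q] some_pending that by (simp add: turn_rule_def)
  show "turn B (Suc q) - turn B q \<le> max_accel_wcet S (owner q)"
  proof (cases "\<exists>k p. pending S B q (owner q) k p")
    case True
    then obtain k' p' where served: "served B q = Some (owner q, k', p')"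
      using owner_pendingE by blast
    show ?thesis
      using served_pending(3)[OF served] served_demand_le[OF served] by simp
  next
    case False
    then show ?thesis
      using passes max_accel_wcet_nonneg[OF valid tasks] by simp
  qed
  assume i: "owner q = i"
  \<comment> \<open>Otherwise the turn has zero length and so begins after \<open>s\<close>, which
    makes the request itself pending for its owner.\<close>
  then have "\<exists>k p. pending S B q (owner q) k p"
    using passes pend late by fastforce
  then show "\<exists>k p. served B q = Some (i, k, p)"
    using owner_pendingE i by blast
qed

lemma response_time:
  assumes i: "i \<in> tasks S" and accel: "is_accel_phase S i p" and s: "ready S B i k p = Some s"
  shows "\<exists>f. completion B i k p = Some f \<and>
    f - s \<le> phase_wcet S i (phases S i ! p) + (\<Sum>h\<in>tasks S - {i}. max_accel_wcet S h)"
proof -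
  let ?I = "\<Sum>h\<in>tasks S - {i}. max_accel_wcet S h"
  have p: "p < length (phases S i)"
    using accel by (simp add: is_accel_phase_def)
  have wcet: "0 \<le> phase_wcet S i (phases S i ! p)"
    using demand_bounds[OF i p, of k] by linarith
  have I: "0 \<le> ?I"
    by (rule sum_nonneg) (use max_accel_wcet_nonneg[OF valid] in auto)
  obtain q where q: "turn B q \<le> s" "s < turn B (Suc q)"
  proof -
    obtain q1 where "s < turn B q1"
      using rr unfolding round_robin_def by blast
    moreover have "\<not> s < turn B 0"
      using ready_nonneg[OF i p s] turn_0 by simp
    ultimately obtain q where "\<not> s < turn B q" "s < turn B (Suc q)"
      using ex_least_nat_less[of "\<lambda>q. s < turn B q"] by blast
    then show thesis
      using that[of q] by simp
  qed
  show ?thesis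
  proof (cases "\<exists>q'<q. served B q' = Some (i, k, p)")
    case True
    then obtain q' where q': "q' < q" "served B q' = Some (i, k, p)"
      by blast
    \<comment> \<open>The request completes by \<open>s\<close>, so its delay is at most 0 while the
      bound is nonnegative.\<close>
    have "turn B (Suc q') \<le> s"
      using turn_mono[of "Suc q'" q] q' q by simp
    then show ?thesis
      using completion_served[OF q'(2)] wcet I by auto
  next
    case unserved: False
    have "i \<in> set cyc"
      using i set_cyc by simp
    with distinct_cyc obtain m where m: "q \<le> m" "owner m = i" "inj_on owner {q..<m}"
      "owner ` {q..<m} \<subseteq> tasks S - {i}"
      using next_visit[of cyc i q] set_cyc by metis
    have others: "owner r \<in> tasks S - {i}" if "r \<in> {q..<m}" for r
      using subsetD[OF m(4) imageI[OF that]] .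
    have unserved': "\<forall>q'<r. served B q' \<noteq> Some (i, k, p)" if "r \<in> {q..m}" for r
    proof (intro allI impI notI)
      fix q' assume q': "q' < r" "served B q' = Some (i, k, p)"
      then have "q \<le> q'"
        using unserved by (meson not_le)
      with q' that show False
        using others[of q'] served_pending(1)[OF q'(2)] by simp
    qed
    have late: "s < turn B (Suc r)" if "q \<le> r" for r
      using turn_mono[of "Suc q" "Suc r"] that q by linarith
    \<comment> \<open>The wait telescopes into turn lengths; as the owners are distinct, the sum
      over turns then becomes a sum over tasks other than \<open>i\<close>.\<close>
    have "turn B m - turn B q = (\<Sum>r\<in>{q..<m}. turn B (Suc r) - turn B r)"
      using sum_Suc_diff'[OF m(1), of "turn B"] by simp
    also have "\<dots> \<le> (\<Sum>r\<in>{q..<m}. max_accel_wcet S (owner r))"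
    proof (rule sum_mono)
      fix r assume "r \<in> {q..<m}"
      then show "turn B (Suc r) - turn B r \<le> max_accel_wcet S (owner r)"
        using turn_while_waiting(1)[OF i accel s late unserved'] others[of r] by simp
    qed
    also have "\<dots> = (\<Sum>h\<in>owner ` {q..<m}. max_accel_wcet S h)"
      by (simp add: sum.reindex[OF m(3)])
    also have "\<dots> \<le> ?I"
      by (rule sum_mono2) (use finite_tasks m(4) max_accel_wcet_nonneg[OF valid] in auto)
    finally have wait: "turn B m - s \<le> ?I"
      using q by linarith
    obtain k' p' where served: "served B m = Some (i, k', p')"
      using turn_while_waiting(2)[OF i accel s late[OF m(1)] unserved'[of m]] m(1,2) i by auto
    obtain r' where r': "ready S B i k' p' = Some r'" "r' \<le> turn B m"
      using served_pending(2)[OF served] by (auto simp: pending_def)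
    have p': "p' < length (phases S i)"
      using pendingD(3)[OF served_pending(2)[OF served]] .
    consider "k' = k" "p' = p" | "k' < k \<or> k' = k \<and> p' < p" | "k < k' \<or> k = k' \<and> p < p'"
      by linarith
    then show ?thesis
    proof cases
      case 1
      then show ?thesis
        using completion_served[OF served] served_pending(3)[OF served]
          demand_bounds(2)[OF i p, of k] wait by auto
    next
      case 2
      \<comment> \<open>An earlier phase is complete by \<open>s\<close>, but a phase served in turn
        \<open>m\<close> completes only after \<open>s\<close>.\<close>
      obtain f where "completion B i k' p' = Some f" "f \<le> s"
        using phases_sequential[OF i p' p s 2] .
      then have False
        using completion_served[OF served] late[OF m(1)] by simp
      then show ?thesis ..
    next
      case 3
      \<comment> \<open>A later phase is ready by the start of turn \<open>m\<close> only if the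
        request has completed by then, so the waiting bound alone suffices.\<close>
      obtain f where "completion B i k p = Some f" "f \<le> r'"
        using phases_sequential[OF i p p' r'(1) 3] .
      then show ?thesis
        using r'(2) wait wcet by auto
    qed
  qed
qed

end

theorem lemma1:
  fixes S :: "('t, 'c) system" and B :: "('t, 'c) schedule"
    and i :: 't and j x :: nat
  assumes "valid_system S"
    and "i \<in> tasks S"
    and "j \<in> accel_segments S i"
    and "x < length (ss_task S i)"
    and "ss_task S i ! x = susp_region j"
    and "legal_schedule S B"
    and "round_robin S B"
  shows "\<forall>k s. region_start S B i k x = Some s \<longrightarrow>
           (\<exists>f. region_end S B i k x = Some f \<and>
              f - s \<le> accel_wcet S i j + (\<Sum>(h, u)\<in>interference S i. accel_wcet S h u))"
proof -
  obtain cyc where "distinct cyc" "set cyc = tasks S"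
    "\<And>q. turn_rule S B (cyc ! (q mod length cyc)) q"
    using assms(7) by (auto simp: round_robin_def)
  then interpret round_robin_run S B cyc
    using assms by unfold_locales auto
  let ?p = "region_pos S i x"
  have pos: "?p < length (phases S i)" "phases S i ! ?p = Processing j"
    using phases_region_pos[OF assms(4)] assms(5) by (auto simp: susp_region_def)
  have "is_accel_phase S i ?p"
    using pos assms(3) by (simp add: is_accel_phase_def accel_segments_def)
  note bound = response_time[OF assms(2) this, unfolded pos(2) phase_wcet_Processing[OF assms(3)]]
  show ?thesis
    \<comment> \<open>A suspension region holds exactly one phase, so the last index in
      \<open>region_end\<close> is again \<open>?p\<close>, and start and end are readiness and
      completion of the same phase.\<close>
    using bound assms(5)
    by (simp add: region_start_def region_end_def susp_region_def sum_interference[OF finite_tasks])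
qed

end
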